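(* Let $G$ be a Hausdorff topological group with identity $e$. Then $G$ is $\omega$-balanced and a strict $q$-space if and only if for each open neighborhood $O$ of $e$ in $G$ there is a closed sequentially compact invariant subgroup $H$ of $G$ which is of countable character in $G$, such that $H\subseteq O$, the canonical quotient mapping $p:G\rightarrow G/H$ is sequential-perfect, and the quotient group $G/H$ is metrizable.
   Context: All topological groups and spaces are assumed to be Hausdorff. "Invariant subgroup" means normal subgroup. For a subgroup $H$ of $G$, $G/H$ is the space of left cosets with the quotient topology, and $p:G\to G/H$ is the canonical quotient mapping. A topological group $G$ is $\omega$-balanced if for every neighbourhood $U$ of the identity $e$ there is a countable family $\gamma$ of open neighbourhoods of $e$ such that for each $x\in G$ there is $V\in\gamma$ with $xVx^{-1}\subseteq U$. A space is sequentially compact if every sequence in it has a convergent subsequence; a subset is sequentially compact if it is so as a subspace. A sequence $\{U_n:n\in\omega\}$ of open neighborhoods of a point $x$ in a space $X$ is a $q$-sequence at $x$ if every sequence $\{x_n\}_{n\in\omega}$ of points of $X$ with $x_n\in U_n$ for each $n\in\omega$ has a point of accumulation in $X$ (a point each of whose neighborhoods contains $x_n$ for infinitely many $n$). A point $x\in X$ is a strict $q$-point if there is a $q$-sequence $\{U_n:n\in\omega\}$ at $x$ such that $\bigcap_{n\in\omega}U_n$ is a sequentially compact set. A space is a strict $q$-space if each of its points is a strict $q$-point. A subset $A$ of a space $X$ is of countable character in $X$ if there is a countable family $\{U_n:n\in\omega\}$ of open neighborhoods of $A$ (open sets containing $A$) such that each open neighborhood $U$ of $A$ contains some $U_n$.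 A continuous mapping $f:X\to Y$ is sequential-perfect if $f$ is closed and $f^{-1}(y)$ is a sequentially compact set for each $y\in Y$. *)

theory Defs
  imports "HOL-Analysis.Analysis" "HOL-Algebra.Coset"
begin

locale topological_group = group G
  for G :: "('a, 'b) monoid_scheme" (structure) and T :: "'a topology" +
  assumes topspace_eq_carrier: "topspace T = carrier G"
    and continuous_mult: "continuous_map (prod_topology T T) T (\<lambda>(x, y). x \<otimes> y)"
    and continuous_inv: "continuous_map T T (\<lambda>x. inv x)"

definition neighbourhood_in :: "'a topology \<Rightarrow> 'a \<Rightarrow> 'a set \<Rightarrow> bool" where
  "neighbourhood_in X x N \<longleftrightarrow> N \<subseteq> topspace X \<and> (\<exists>W. openin X W \<and> x \<in> W \<and> W \<subseteq> N)"

definition omega_balanced :: "('a, 'b) monoid_scheme \<Rightarrow> 'a topology \<Rightarrow> bool" where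
  "omega_balanced G T \<longleftrightarrow>
     (\<forall>U. neighbourhood_in T \<one>\<^bsub>G\<^esub> U \<longrightarrow>
       (\<exists>\<gamma>. countable \<gamma> \<and> (\<forall>V\<in>\<gamma>. openin T V \<and> \<one>\<^bsub>G\<^esub> \<in> V) \<and>
         (\<forall>x\<in>carrier G. \<exists>V\<in>\<gamma>. (\<lambda>v. x \<otimes>\<^bsub>G\<^esub> v \<otimes>\<^bsub>G\<^esub> inv\<^bsub>G\<^esub> x) ` V \<subseteq> U)))"

definition seq_compact_space :: "'a topology \<Rightarrow> bool" where
  "seq_compact_space X \<longleftrightarrow>
     (\<forall>s :: nat \<Rightarrow> 'a. range s \<subseteq> topspace X \<longrightarrow>
       (\<exists>l r. strict_mono (r :: nat \<Rightarrow> nat) \<and> limitin X (s \<circ> r) l sequentially))"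

definition seq_compactin :: "'a topology \<Rightarrow> 'a set \<Rightarrow> bool" where
  "seq_compactin X S \<longleftrightarrow> S \<subseteq> topspace X \<and> seq_compact_space (subtopology X S)"

definition accumulation_point_of_seq :: "'a topology \<Rightarrow> (nat \<Rightarrow> 'a) \<Rightarrow> 'a \<Rightarrow> bool" where
  "accumulation_point_of_seq X s a \<longleftrightarrow>
     a \<in> topspace X \<and> (\<forall>N. neighbourhood_in X a N \<longrightarrow> infinite {n. s n \<in> N})"

definition q_sequence :: "'a topology \<Rightarrow> 'a \<Rightarrow> (nat \<Rightarrow> 'a set) \<Rightarrow> bool" where
  "q_sequence X x U \<longleftrightarrow>
     (\<forall>n. openin X (U n) \<and> x \<in> U n) \<and>
     (\<forall>s. (\<forall>n. s n \<in> U n) \<longrightarrow> (\<exists>a. accumulation_point_of_seq X s a))"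

definition strict_q_point :: "'a topology \<Rightarrow> 'a \<Rightarrow> bool" where
  "strict_q_point X x \<longleftrightarrow> (\<exists>U. q_sequence X x U \<and> seq_compactin X (\<Inter>n. U n))"

definition strict_q_space :: "'a topology \<Rightarrow> bool" where
  "strict_q_space X \<longleftrightarrow> (\<forall>x\<in>topspace X. strict_q_point X x)"

definition countable_character_in :: "'a topology \<Rightarrow> 'a set \<Rightarrow> bool" where
  "countable_character_in X A \<longleftrightarrow>
     A \<subseteq> topspace X \<and>
     (\<exists>U :: nat \<Rightarrow> 'a set. (\<forall>n. openin X (U n) \<and> A \<subseteq> U n) \<and>
       (\<forall>W. openin X W \<and> A \<subseteq> W \<longrightarrow> (\<exists>n. U n \<subseteq> W)))"

definition sequential_perfect_map :: "'a topology \<Rightarrow> 'b topology \<Rightarrow> ('a \<Rightarrow> 'b) \<Rightarrow> bool" where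
  "sequential_perfect_map X Y f \<longleftrightarrow>
     continuous_map X Y f \<and> closed_map X Y f \<and>
     (\<forall>y\<in>topspace Y. seq_compactin X {x \<in> topspace X. f x = y})"

definition quotient_topology :: "'a topology \<Rightarrow> ('a \<Rightarrow> 'b) \<Rightarrow> 'b topology" where
  "quotient_topology X f =
     topology (\<lambda>S. S \<subseteq> f ` topspace X \<and> openin X {x \<in> topspace X. f x \<in> S})"

lemma istopology_quotient_topology:
  "istopology (\<lambda>S. S \<subseteq> f ` topspace X \<and> openin X {x \<in> topspace X. f x \<in> S})"
proof -
  have Int: "{x \<in> topspace X. f x \<in> S \<inter> R} = {x \<in> topspace X. f x \<in> S} \<inter> {x \<in> topspace X. f x \<in> R}"
    for S R by auto
  have Un: "{x \<in> topspace X. f x \<in> \<Union>\<K>} = (\<Union>S\<in>\<K>. {x \<in> topspace X. f x \<in> S})" for \<K>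
    by auto
  show ?thesis
    unfolding istopology_def Int Un by (intro conjI allI impI openin_Int openin_Union) auto
qed

lemma openin_quotient_topology:
  "openin (quotient_topology X f) S \<longleftrightarrow>
     S \<subseteq> f ` topspace X \<and> openin X {x \<in> topspace X. f x \<in> S}"
  unfolding quotient_topology_def
  using istopology_quotient_topology[of f X] by (simp add: topology_inverse')

lemma topspace_quotient_topology: "topspace (quotient_topology X f) = f ` topspace X"
proof
  show "topspace (quotient_topology X f) \<subseteq> f ` topspace X"
    using openin_quotient_topology openin_topspace by metis
  have "{x \<in> topspace X. f x \<in> f ` topspace X} = topspace X"
    by auto
  then have "openin (quotient_topology X f) (f ` topspace X)"
    by (simp add: openin_quotient_topology)
  then show "f ` topspace X \<subseteq> topspace (quotient_topology X f)"
    by (rule openin_subset)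
qed

lemma quotient_map_quotient_topology: "quotient_map X (quotient_topology X f) f"
  by (auto simp: quotient_map_def topspace_quotient_topology openin_quotient_topology)

abbreviation coset_proj :: "('a, 'b) monoid_scheme \<Rightarrow> 'a set \<Rightarrow> 'a \<Rightarrow> 'a set" where
  "coset_proj G H \<equiv> (\<lambda>x. x <#\<^bsub>G\<^esub> H)"

definition coset_topology :: "('a, 'b) monoid_scheme \<Rightarrow> 'a topology \<Rightarrow> 'a set \<Rightarrow> 'a set topology" where
  "coset_topology G T H = quotient_topology T (coset_proj G H)"

text \<open>The library's factor group consists of right cosets; for a normal subgroup its
  carrier is the space of left cosets, so \<^const>\<open>coset_topology\<close> is a topology on it.\<close>

lemma (in topological_group) topspace_coset_topology_normal:
  assumes "H \<lhd> G"
  shows "topspace (coset_topology G T H) = carrier (G Mod H)"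
  using normal.coset_eq[OF assms]
  by (auto simp: coset_topology_def topspace_quotient_topology topspace_eq_carrier
      FactGroup_def RCOSETS_def)

end

theory Submission
  imports Defs
begin

text \<open>If the identity has a $q$-sequence $(U_n)$ with sequentially compact intersection, then
  $\omega$-balancedness yields symmetric neighbourhoods $V_n$ with $V_{n+1}^3 \subseteq V_n$ and
  $V_{n+1} \subseteq O \cap U_n$, such that every conjugate of each $V_n$ contains some $V_m$.
  Their intersection $H$ is a closed normal subgroup, and accumulation points of sequences
  $x_n \in V_n$ lie in $H$, so the $V_n$ form a base at $H$. This makes the projection closed and
  lets the left-invariant Birkhoff-Kakutani pseudometric of $(V_n)$ induce the quotient topology
  on $G/H$. The converse needs only that $H$ is normal, sequentially compact and of countable
  character: conjugating neighbourhoods of $H$ gives $\omega$-balancedness, and a decreasing base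
  at $H$ is a $q$-sequence with intersection $H$.\<close>

section \<open>Sequences and quotient metrics\<close>

text \<open>Convergence in a subspace is convergence in \<open>X\<close> to a point of
  \<open>S\<close>. This form keeps all limits in \<open>X\<close>.\<close>

lemma seq_compactin_iff:
  "seq_compactin X S \<longleftrightarrow> S \<subseteq> topspace X \<and>
     (\<forall>s :: nat \<Rightarrow> 'a. range s \<subseteq> S \<longrightarrow>
        (\<exists>l\<in>S. \<exists>r :: nat \<Rightarrow> nat. strict_mono r \<and> limitin X (s \<circ> r) l sequentially))"
proof (cases "S \<subseteq> topspace X")
  case True
  then have "topspace (subtopology X S) = S"
    by auto
  moreover have "limitin (subtopology X S) (s \<circ> r) l sequentially \<longleftrightarrow>
      l \<in> S \<and> limitin X (s \<circ> r) l sequentially"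
    if "range s \<subseteq> S" for s :: "nat \<Rightarrow> 'a" and r :: "nat \<Rightarrow> nat" and l
    using that by (auto simp: limitin_subtopology image_subset_iff)
  ultimately show ?thesis
    unfolding seq_compactin_def seq_compact_space_def using True by (simp, metis)
qed (simp add: seq_compactin_def)

text \<open>The convergent subsequence comes from \<open>K\<close>; since \<open>S\<close> is
  closed, its limit cannot leave \<open>S\<close>.\<close>

lemma seq_compactin_closed_subset:
  assumes "seq_compactin X K" "closedin X S" "S \<subseteq> K"
  shows "seq_compactin X S"
  unfolding seq_compactin_iff
proof (intro conjI allI impI)
  show "S \<subseteq> topspace X"
    using assms(2) by (rule closedin_subset)
  fix s :: "nat \<Rightarrow> 'a"
  assume s: "range s \<subseteq> S"
  then obtain l r where r: "strict_mono (r :: nat \<Rightarrow> nat)" "limitin X (s \<circ> r) l sequentially"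
    using assms(1,3) unfolding seq_compactin_iff by (meson order_trans)
  moreover have "l \<in> S"
    using s by (intro limitin_closedin[OF r(2) assms(2)]) (auto simp: image_subset_iff)
  ultimately show "\<exists>l\<in>S. \<exists>r. strict_mono r \<and> limitin X (s \<circ> r) l sequentially"
    by blast
qed

lemma seq_compactin_image:
  assumes "continuous_map X Y f" "seq_compactin X S"
  shows "seq_compactin Y (f ` S)"
  unfolding seq_compactin_iff
proof (intro conjI allI impI)
  show "f ` S \<subseteq> topspace Y"
    using assms by (auto simp: seq_compactin_iff continuous_map_def)
  fix s :: "nat \<Rightarrow> 'b"
  assume "range s \<subseteq> f ` S"
  then have "\<forall>n. \<exists>x. x \<in> S \<and> s n = f x"
    by blast
  then obtain t where t: "\<And>n. t n \<in> S" "\<And>n. s n = f (t n)"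
    by metis
  then have "range t \<subseteq> S"
    by blast
  then obtain l r where r: "l \<in> S" "strict_mono (r :: nat \<Rightarrow> nat)" "limitin X (t \<circ> r) l sequentially"
    using assms(2) unfolding seq_compactin_iff by metis
  have "f \<circ> (t \<circ> r) = s \<circ> r"
    using t by auto
  then have "limitin Y (s \<circ> r) (f l) sequentially"
    using continuous_map_limit[OF assms(1) r(3)] by simp
  with r show "\<exists>l\<in>f ` S. \<exists>r. strict_mono r \<and> limitin Y (s \<circ> r) l sequentially"
    by blast
qed

lemma accumulation_point_of_seq_iff:
  "accumulation_point_of_seq X s a \<longleftrightarrow>
     a \<in> topspace X \<and> (\<forall>W. openin X W \<longrightarrow> a \<in> W \<longrightarrow> infinite {n. s n \<in> W})"
  (is "?L \<longleftrightarrow> ?R")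
proof
  assume ?L
  then show ?R
    unfolding accumulation_point_of_seq_def neighbourhood_in_def
    by (meson openin_subset order_refl)
next
  assume R: ?R
  have "infinite {n. s n \<in> N}" if "openin X W" "a \<in> W" "W \<subseteq> N" for N W
  proof
    assume "finite {n. s n \<in> N}"
    moreover have "{n. s n \<in> W} \<subseteq> {n. s n \<in> N}"
      using that by blast
    ultimately show False
      using R that finite_subset by blast
  qed
  with R show ?L
    unfolding accumulation_point_of_seq_def neighbourhood_in_def by blast
qed

lemma accumulation_point_of_seq_continuous_image:
  assumes "continuous_map X Y f" "accumulation_point_of_seq X s a"
  shows "accumulation_point_of_seq Y (\<lambda>n. f (s n)) (f a)"
  unfolding accumulation_point_of_seq_iff
proof (intro conjI allI impI)
  have a: "a \<in> topspace X"
    using assms(2) by (simp add: accumulation_point_of_seq_iff)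
  then show "f a \<in> topspace Y"
    using assms(1) by (auto simp: continuous_map_def)
  fix W
  assume W: "openin Y W" "f a \<in> W"
  have "openin X {x \<in> topspace X. f x \<in> W}"
    using assms(1) W(1) by (simp add: continuous_map_def)
  then have "infinite {n. s n \<in> {x \<in> topspace X. f x \<in> W}}"
    using assms(2) a W(2) unfolding accumulation_point_of_seq_iff by blast
  then show "infinite {n. f (s n) \<in> W}"
    by (rule contrapos_nn) (erule rev_finite_subset, blast)
qed

text \<open>A q-sequence is carried along by \<open>f\<close>: pull a selection back through
  \<open>g\<close>, take an accumulation point there and push it forward. Applied to translations,
  this reduces the strict q-property to the identity.\<close>

lemma strict_q_point_homeomorphic_image:
  assumes fg: "homeomorphic_maps X X f g" and x: "x \<in> topspace X" "strict_q_point X x"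
  shows "strict_q_point X (f x)"
proof -
  have cf: "continuous_map X X f" and cg: "continuous_map X X g"
    and gf: "\<And>y. y \<in> topspace X \<Longrightarrow> g (f y) = y" and fg': "\<And>y. y \<in> topspace X \<Longrightarrow> f (g y) = y"
    using fg by (auto simp: homeomorphic_maps_def)
  obtain U where U: "q_sequence X x U" and sc: "seq_compactin X (\<Inter>n. U n)"
    using x(2) by (auto simp: strict_q_point_def)
  \<comment> \<open>This is the image of \<open>U n\<close> under \<open>f\<close>, written as a
    preimage under \<open>g\<close> so that continuity of \<open>g\<close> makes it open.\<close>
  define W where "W n = {y \<in> topspace X. g y \<in> U n}" for n
  have "q_sequence X (f x) W"
    unfolding q_sequence_def
  proof (intro conjI allI impI)
    fix n
    show "openin X (W n)"
      using U cg by (auto simp: W_def q_sequence_def continuous_map_def)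
    show "f x \<in> W n"
      using U cf x(1) gf by (auto simp: W_def q_sequence_def continuous_map_def)
  next
    fix s
    assume s: "\<forall>n. s n \<in> W n"
    then have "\<forall>n. g (s n) \<in> U n"
      by (simp add: W_def)
    then obtain a where "accumulation_point_of_seq X (\<lambda>n. g (s n)) a"
      using U unfolding q_sequence_def by meson
    then have "accumulation_point_of_seq X (\<lambda>n. f (g (s n))) (f a)"
      by (rule accumulation_point_of_seq_continuous_image[OF cf])
    moreover have "f (g (s n)) = s n" for n
      using s fg' by (auto simp: W_def)
    ultimately show "\<exists>a. accumulation_point_of_seq X s a"
      by auto
  qed
  moreover have "(\<Inter>n. W n) = f ` (\<Inter>n. U n)"
  proof
    show "(\<Inter>n. W n) \<subseteq> f ` (\<Inter>n. U n)"
    proof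
      fix y
      assume y: "y \<in> (\<Inter>n. W n)"
      then have "g y \<in> (\<Inter>n. U n)" "f (g y) = y"
        using fg' by (auto simp: W_def)
      then show "y \<in> f ` (\<Inter>n. U n)"
        by (metis imageI)
    qed
    have "z \<in> topspace X" if "\<forall>n. z \<in> U n" for z
      using that sc by (auto simp: seq_compactin_def)
    then show "f ` (\<Inter>n. U n) \<subseteq> (\<Inter>n. W n)"
      using cf gf by (auto simp: W_def continuous_map_def)
  qed
  then have "seq_compactin X (\<Inter>n. W n)"
    using seq_compactin_image[OF cf sc] by simp
  ultimately show ?thesis
    unfolding strict_q_point_def by blast
qed

text \<open>A pseudometric whose zero classes are the fibres of \<open>f\<close> descends to a
  metric on the image. Only saturated sets have to be compared in \<open>opens\<close>, because
  these are exactly what the quotient topology sees.\<close>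

lemma metrizable_quotient_topology:
  fixes d :: "'a \<Rightarrow> 'a \<Rightarrow> real"
  assumes d_nonneg: "\<And>x y. x \<in> topspace X \<Longrightarrow> y \<in> topspace X \<Longrightarrow> 0 \<le> d x y"
    and d_commute: "\<And>x y. x \<in> topspace X \<Longrightarrow> y \<in> topspace X \<Longrightarrow> d x y = d y x"
    and d_zero: "\<And>x y. x \<in> topspace X \<Longrightarrow> y \<in> topspace X \<Longrightarrow> d x y = 0 \<longleftrightarrow> f x = f y"
    and d_triangle: "\<And>x y z. x \<in> topspace X \<Longrightarrow> y \<in> topspace X \<Longrightarrow> z \<in> topspace X \<Longrightarrow>
        d x z \<le> d x y + d y z"
    and opens: "\<And>S. S \<subseteq> f ` topspace X \<Longrightarrow> openin X {x \<in> topspace X. f x \<in> S} \<longleftrightarrow>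
        (\<forall>x\<in>topspace X. f x \<in> S \<longrightarrow> (\<exists>e>0. \<forall>y\<in>topspace X. d x y < e \<longrightarrow> f y \<in> S))"
  shows "metrizable_space (quotient_topology X f)"
proof -
  define M where "M = f ` topspace X"
  define g where "g = inv_into (topspace X) f"
  \<comment> \<open>The value 0 off \<open>M\<close> is a default: \<open>Metric_space\<close> asks
    for nonnegativity and symmetry at all arguments, not only at points of \<open>M\<close>.\<close>
  define D where "D A B = (if A \<in> M \<and> B \<in> M then d (g A) (g B) else 0)" for A B
  have g: "g A \<in> topspace X" "f (g A) = A" if "A \<in> M" for A
    using that by (auto simp: M_def g_def inv_into_into f_inv_into_f)
  interpret Metric_space M D
  proof
    show "0 \<le> D x y" "D x y = D y x" for x y
      using d_nonneg d_commute g by (auto simp: D_def)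
    show "D x y = 0 \<longleftrightarrow> x = y" if "x \<in> M" "y \<in> M" for x y
      using that g d_zero[of "g x" "g y"] by (auto simp: D_def)
    show "D x z \<le> D x y + D y z" if "x \<in> M" "y \<in> M" "z \<in> M" for x y z
      using that g d_triangle by (auto simp: D_def)
  qed
  \<comment> \<open>Independence of representatives: replacing a point by another one in its fibre
    costs distance 0, so the triangle inequality gives both estimates.\<close>
  have D: "D (f x) (f y) = d x y" if "x \<in> topspace X" "y \<in> topspace X" for x y
  proof -
    have M: "f x \<in> M" "f y \<in> M"
      using that by (auto simp: M_def)
    define x' y' where "x' = g (f x)" and "y' = g (f y)"
    have x': "x' \<in> topspace X" "y' \<in> topspace X" "f x' = f x" "f y' = f y"
      using g M by (auto simp: x'_def y'_def)
    then have "d x x' = 0" "d x' x = 0" "d y y' = 0" "d y' y = 0"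
      by (simp_all add: d_zero that)
    moreover have "d x y \<le> d x x' + d x' y" "d x' y \<le> d x' y' + d y' y"
      "d x' y' \<le> d x' x + d x y'" "d x y' \<le> d x y + d y y'"
      using that x' d_triangle by auto
    ultimately have "d x' y' = d x y"
      by linarith
    then show ?thesis
      using M by (simp add: D_def x'_def y'_def)
  qed
  have "openin (quotient_topology X f) S = openin mtopology S" for S
  proof (cases "S \<subseteq> M")
    case True
    have "openin mtopology S \<longleftrightarrow> (\<forall>x\<in>topspace X. f x \<in> S \<longrightarrow> (\<exists>e>0. mball (f x) e \<subseteq> S))"
      unfolding openin_mtopology using True by (auto simp: M_def)
    also have "\<dots> \<longleftrightarrow> (\<forall>x\<in>topspace X. f x \<in> S \<longrightarrow> (\<exists>e>0. \<forall>y\<in>topspace X. d x y < e \<longrightarrow> f y \<in> S))"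
    proof -
      have "mball (f x) e \<subseteq> S \<longleftrightarrow> (\<forall>y\<in>topspace X. d x y < e \<longrightarrow> f y \<in> S)"
        if "x \<in> topspace X" for x e
        unfolding mball_def unfolding M_def using that D by auto
      then show ?thesis
        by auto
    qed
    finally show ?thesis
      using True opens[of S] by (simp add: openin_quotient_topology M_def)
  next
    case False
    then have "\<not> openin mtopology S"
      by (simp add: openin_mtopology)
    moreover have "\<not> openin (quotient_topology X f) S"
      using False by (simp add: openin_quotient_topology M_def)
    ultimately show ?thesis
      by simp
  qed
  then have "quotient_topology X f = mtopology"
    by (simp add: topology_eq)
  then show ?thesis
    using metrizable_space_mtopology by simp
qed

text \<open>The entry \<open>b\<close> is the first one at which the partial sums reach
  \<open>t\<close>: the part before it has not passed \<open>t\<close>, and at most the remainder is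
  left after it.\<close>

lemma split_list_sum:
  fixes f :: "'a \<Rightarrow> real"
  assumes "xs \<noteq> []" "0 \<le> t" "t \<le> sum_list (map f xs)"
  shows "\<exists>as b cs. xs = as @ b # cs \<and> sum_list (map f as) \<le> t \<and>
           sum_list (map f cs) \<le> sum_list (map f xs) - t"
  using assms
proof (induction xs arbitrary: t)
  case (Cons x xs)
  show ?case
  proof (cases "t \<le> f x")
    case True
    with Cons.prems have "x # xs = [] @ x # xs \<and> sum_list (map f []) \<le> t \<and>
        sum_list (map f xs) \<le> sum_list (map f (x # xs)) - t"
      by simp
    then show ?thesis
      by blast
  next
    case False
    with Cons.prems have "xs \<noteq> []" "0 \<le> t - f x" "t - f x \<le> sum_list (map f xs)"
      by auto
    then obtain as b cs where "xs = as @ b # cs" "sum_list (map f as) \<le> t - f x"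
        "sum_list (map f cs) \<le> sum_list (map f xs) - (t - f x)"
      using Cons.IH by blast
    then have "x # xs = (x # as) @ b # cs \<and> sum_list (map f (x # as)) \<le> t \<and>
        sum_list (map f cs) \<le> sum_list (map f (x # xs)) - t"
      by simp
    then show ?thesis
      by blast
  qed
qed simp

section \<open>Neighbourhoods in topological groups\<close>

context topological_group
begin

lemma openin_subset_carrier: "openin T U \<Longrightarrow> U \<subseteq> carrier G"
  using openin_subset topspace_eq_carrier by metis

lemma continuous_map_mult:
  assumes "continuous_map X T f" "continuous_map X T g"
  shows "continuous_map X T (\<lambda>x. f x \<otimes> g x)"
  using continuous_map_compose[OF continuous_map_paired[THEN iffD2, OF conjI[OF assms]] continuous_mult]
  by (simp add: o_def)

lemma continuous_map_translation:
  assumes "a \<in> carrier G" "b \<in> carrier G"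
  shows "continuous_map T T (\<lambda>x. a \<otimes> x \<otimes> b)"
  by (intro continuous_map_mult) (use assms topspace_eq_carrier in auto)

lemma continuous_map_left_translation:
  assumes "a \<in> carrier G"
  shows "continuous_map T T (\<lambda>x. a \<otimes> x)"
  by (intro continuous_map_mult) (use assms topspace_eq_carrier in auto)

lemma openin_translation_vimage:
  assumes "openin T U" "a \<in> carrier G" "b \<in> carrier G"
  shows "openin T {x \<in> carrier G. a \<otimes> x \<otimes> b \<in> U}"
  using continuous_map_translation[OF assms(2,3)] assms(1)
  by (simp add: continuous_map_def topspace_eq_carrier)

lemma openin_left_translation_vimage:
  assumes "openin T U" "a \<in> carrier G"
  shows "openin T {x \<in> carrier G. a \<otimes> x \<in> U}"
  using continuous_map_left_translation[OF assms(2)] assms(1)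
  by (simp add: continuous_map_def topspace_eq_carrier)

lemma openin_inv_vimage:
  assumes "openin T U"
  shows "openin T {x \<in> carrier G. inv x \<in> U}"
  using continuous_inv assms by (simp add: continuous_map_def topspace_eq_carrier)

lemma square_subset_neighbourhood:
  assumes "openin T U" "\<one> \<in> U"
  obtains W where "openin T W" "\<one> \<in> W" "\<And>a b. a \<in> W \<Longrightarrow> b \<in> W \<Longrightarrow> a \<otimes> b \<in> U"
proof -
  have "openin (prod_topology T T) {p \<in> topspace (prod_topology T T). (\<lambda>(x, y). x \<otimes> y) p \<in> U}"
    using continuous_mult assms(1) by (simp only: continuous_map_def)
  moreover have "(\<one>, \<one>) \<in> {p \<in> topspace (prod_topology T T). (\<lambda>(x, y). x \<otimes> y) p \<in> U}"
    using assms(2) by (simp add: topspace_eq_carrier)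
  ultimately obtain A B where AB: "openin T A" "openin T B" "\<one> \<in> A" "\<one> \<in> B"
      "A \<times> B \<subseteq> {p \<in> topspace (prod_topology T T). (\<lambda>(x, y). x \<otimes> y) p \<in> U}"
    unfolding openin_prod_topology_alt by meson
  show thesis
  proof
    show "openin T (A \<inter> B)" "\<one> \<in> A \<inter> B"
      using AB by auto
    show "a \<otimes> b \<in> U" if "a \<in> A \<inter> B" "b \<in> A \<inter> B" for a b
      using AB(5) that by auto
  qed
qed

text \<open>Three factors, rather than two, are what the chain estimate for the metric consumes: a
  chain is cut into an initial part, one middle element and a final part.\<close>

definition shrinks_to :: "'a set \<Rightarrow> 'a set \<Rightarrow> bool" where
  "shrinks_to U W \<longleftrightarrow> openin T W \<and> \<one> \<in> W \<and> (\<forall>a\<in>W. inv a \<in> W) \<and>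
     (\<forall>a\<in>W. \<forall>b\<in>W. \<forall>c\<in>W. a \<otimes> b \<otimes> c \<in> U)"

text \<open>Apply continuity of multiplication twice and symmetrize. The first two factors multiply
  into \<open>A\<close>, the third lies in \<open>A\<close>, and \<open>A\<close> squared lies in
  \<open>U\<close>.\<close>

lemma ex_shrinks_to:
  assumes "openin T U" "\<one> \<in> U"
  shows "\<exists>W. shrinks_to U W"
proof -
  obtain A where A: "openin T A" "\<one> \<in> A" "\<And>a b. a \<in> A \<Longrightarrow> b \<in> A \<Longrightarrow> a \<otimes> b \<in> U"
    using square_subset_neighbourhood[OF assms] by blast
  obtain B where B: "openin T B" "\<one> \<in> B" "\<And>a b. a \<in> B \<Longrightarrow> b \<in> B \<Longrightarrow> a \<otimes> b \<in> A"
    using square_subset_neighbourhood[OF A(1,2)] by blast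
  have B_sub: "b \<in> A" if "b \<in> B" for b
    using B(3)[OF that B(2)] that openin_subset_carrier[OF B(1)] by auto
  define W where "W = B \<inter> {x \<in> carrier G. inv x \<in> B}"
  have "shrinks_to U W"
    unfolding shrinks_to_def
  proof (intro conjI ballI)
    show "openin T W"
      unfolding W_def using B(1) openin_inv_vimage by blast
    show "\<one> \<in> W"
      using B(2) by (simp add: W_def)
    show "inv a \<in> W" if "a \<in> W" for a
      using that by (auto simp: W_def)
    show "a \<otimes> b \<otimes> c \<in> U" if "a \<in> W" "b \<in> W" "c \<in> W" for a b c
      using that A(3) B(3) B_sub by (auto simp: W_def)
  qed
  then show ?thesis ..
qed

lemma shrinks_to_subset: "shrinks_to U W \<Longrightarrow> W \<subseteq> U"
  unfolding shrinks_to_def using openin_subset_carrier by fastforce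

lemma mem_l_coset_iff:
  assumes "H \<subseteq> carrier G" "x \<in> carrier G" "y \<in> carrier G"
  shows "y \<in> x <# H \<longleftrightarrow> inv x \<otimes> y \<in> H"
proof
  assume "y \<in> x <# H"
  then show "inv x \<otimes> y \<in> H"
    using assms by (auto simp: l_coset_def m_assoc[symmetric] subset_iff)
next
  assume "inv x \<otimes> y \<in> H"
  moreover have "y = x \<otimes> (inv x \<otimes> y)"
    using assms by (simp add: m_assoc[symmetric])
  ultimately show "y \<in> x <# H"
    unfolding l_coset_def by blast
qed

lemma inv_mult_mult_cancel:
  assumes "x \<in> carrier G" "y \<in> carrier G" "z \<in> carrier G"
  shows "(inv x \<otimes> y) \<otimes> (inv y \<otimes> z) = inv x \<otimes> z"
proof -
  have "y \<otimes> (inv y \<otimes> z) = z"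
    using assms by (simp add: m_assoc[symmetric])
  then show ?thesis
    using assms by (simp add: m_assoc)
qed

lemma l_coset_eq_iff:
  assumes "subgroup H G" "x \<in> carrier G" "y \<in> carrier G"
  shows "x <# H = y <# H \<longleftrightarrow> inv x \<otimes> y \<in> H"
proof -
  have "H \<subseteq> carrier G"
    using assms(1) by (rule subgroup.subset)
  moreover have "y \<in> y <# H"
    using assms mem_l_coset_iff[of H y y] subgroup.one_closed subgroup.subset by fastforce
  ultimately show ?thesis
    using l_repr_independence[OF _ assms(2,1)] mem_l_coset_iff[of H x y] assms by metis
qed

end


section \<open>Normal subgroups of countable character\<close>

context topological_group
begin

text \<open>One countable base at \<open>H\<close> serves every \<open>x\<close>: by normality, the
  preimage of \<open>V\<close> under conjugation by \<open>x\<close> is again an open neighbourhood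
  of \<open>H\<close>, so it contains a member of the base.\<close>

lemma omega_balanced_if_countable_character:
  assumes "\<And>V. openin T V \<Longrightarrow> \<one> \<in> V \<Longrightarrow> \<exists>H. H \<lhd> G \<and> countable_character_in T H \<and> H \<subseteq> V"
  shows "omega_balanced G T"
  unfolding omega_balanced_def
proof (intro allI impI)
  fix U
  assume "neighbourhood_in T \<one> U"
  then obtain V where V: "openin T V" "\<one> \<in> V" "V \<subseteq> U"
    by (auto simp: neighbourhood_in_def)
  obtain H where H: "H \<lhd> G" "countable_character_in T H" "H \<subseteq> V"
    using assms V by blast
  then obtain B :: "nat \<Rightarrow> 'a set" where B: "\<And>n. openin T (B n)" "\<And>n. H \<subseteq> B n"
      "\<And>W. openin T W \<Longrightarrow> H \<subseteq> W \<Longrightarrow> \<exists>n. B n \<subseteq> W"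
    unfolding countable_character_in_def by metis
  have one: "\<one> \<in> H"
    using H(1) normal_imp_subgroup subgroup.one_closed by blast
  have H_carrier: "H \<subseteq> carrier G"
    using H(1) normal_imp_subgroup subgroup.subset by blast
  have "\<exists>W\<in>range B. (\<lambda>v. x \<otimes> v \<otimes> inv x) ` W \<subseteq> U" if x: "x \<in> carrier G" for x
  proof -
    let ?W = "{v \<in> carrier G. x \<otimes> v \<otimes> inv x \<in> V}"
    have "openin T ?W"
      using V(1) x by (intro openin_translation_vimage) auto
    moreover have "H \<subseteq> ?W"
      using H H_carrier x by (auto simp: normal_inv_iff)
    ultimately obtain n where "B n \<subseteq> ?W"
      using B(3) by blast
    then show ?thesis
      using V(3) by blast
  qed
  then show "\<exists>\<gamma>. countable \<gamma> \<and> (\<forall>V\<in>\<gamma>. openin T V \<and> \<one> \<in> V) \<and>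
      (\<forall>x\<in>carrier G. \<exists>V\<in>\<gamma>. (\<lambda>v. x \<otimes> v \<otimes> inv x) ` V \<subseteq> U)"
    using B(1) subsetD[OF B(2) one] by (intro exI[of _ "range B"]) auto
qed

end

text \<open>A decreasing base at \<open>S\<close> works. A selection \<open>s\<close> need not meet
  \<open>S\<close>, but the closure of each of its tails does; sequential compactness is applied to
  points chosen from these intersections.\<close>

lemma strict_q_point_if_seq_compactin:
  assumes T1: "t1_space X" and sc: "seq_compactin X S" and cc: "countable_character_in X S"
    and x: "x \<in> S"
  shows "strict_q_point X x"
proof -
  obtain B :: "nat \<Rightarrow> 'a set" where B: "\<And>n. openin X (B n)" "\<And>n. S \<subseteq> B n"
      "\<And>W. openin X W \<Longrightarrow> S \<subseteq> W \<Longrightarrow> \<exists>n. B n \<subseteq> W"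
    using cc unfolding countable_character_in_def by metis
  \<comment> \<open>Finite intersections turn the base into a decreasing one, so late members of a
    selection lie in every earlier \<open>B m\<close>.\<close>
  define U where "U n = (\<Inter>i\<le>n. B i)" for n
  have U_open: "openin X (U n)" and S_U: "S \<subseteq> U n" for n
    unfolding U_def using B by (auto intro: openin_Inter)
  have U_B: "U n \<subseteq> B m" if "m \<le> n" for m n
    unfolding U_def using that by blast
  have S: "S \<subseteq> topspace X"
    using sc by (simp add: seq_compactin_def)
  \<comment> \<open>For a point \<open>y\<close> outside \<open>S\<close>, its complement is an open
    neighbourhood of \<open>S\<close> by T1, hence some \<open>B n\<close> omits
    \<open>y\<close>.\<close>
  have "(\<Inter>n. U n) \<subseteq> S"
  proof
    fix y
    assume y: "y \<in> (\<Inter>n. U n)"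
    show "y \<in> S"
    proof (rule ccontr)
      assume "y \<notin> S"
      moreover have "y \<in> topspace X"
        using y U_open openin_subset by blast
      then have "closedin X {y}"
        using T1 by (simp add: closedin_t1_singleton)
      then have "openin X (topspace X - {y})"
        by blast
      ultimately obtain n where "B n \<subseteq> topspace X - {y}"
        using B(3) S by blast
      then show False
        using y U_B[of n n] by blast
    qed
  qed
  then have "(\<Inter>n. U n) = S"
    using S_U by blast
  moreover have "q_sequence X x U"
    unfolding q_sequence_def
  proof (intro conjI allI impI)
    show "openin X (U n)" "x \<in> U n" for n
      using U_open S_U x by auto
    fix s
    assume s: "\<forall>n. s n \<in> U n"
    have s_X: "range s \<subseteq> topspace X"
      using s U_open openin_subset by blast
    define F where "F k = X closure_of (s ` {k..})" for k
    have F_mono: "F m \<subseteq> F k" if "k \<le> m" for k m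
      unfolding F_def using that by (intro closure_of_mono) auto
    \<comment> \<open>Otherwise the complement of the closed set \<open>F k\<close> contains some
      \<open>B n\<close>, although \<open>s (max k n)\<close> lies in both \<open>B n\<close> and
      \<open>F k\<close>.\<close>
    have "F k \<inter> S \<noteq> {}" for k
    proof
      assume "F k \<inter> S = {}"
      then have "S \<subseteq> topspace X - F k"
        using S by blast
      moreover have "openin X (topspace X - F k)"
        by (simp add: F_def openin_diff)
      ultimately obtain n where n: "B n \<subseteq> topspace X - F k"
        using B(3) by blast
      have "s (max k n) \<in> B n"
        using s U_B[of n "max k n"] by auto
      moreover have "s (max k n) \<in> F k"
        unfolding F_def using s_X by (intro subsetD[OF closure_of_subset]) auto
      ultimately show False
        using n by blast
    qed
    then have "\<forall>k. \<exists>h. h \<in> F k \<inter> S"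
      by blast
    then obtain h where h: "\<And>k. h k \<in> F k" "\<And>k. h k \<in> S"
      by (metis IntE)
    then have "range h \<subseteq> S"
      by blast
    then obtain l r where r: "strict_mono (r :: nat \<Rightarrow> nat)" "limitin X (h \<circ> r) l sequentially"
      using sc unfolding seq_compactin_iff by metis
    have "accumulation_point_of_seq X s l"
      unfolding accumulation_point_of_seq_iff
    proof (intro conjI allI impI)
      show "l \<in> topspace X"
        using r(2) by (rule limitin_topspace)
      fix W
      assume W: "openin X W" "l \<in> W"
      \<comment> \<open>For large \<open>i\<close> the point \<open>h (r i)\<close> lies in
        \<open>W\<close> and, as \<open>r i\<close> is at least \<open>k\<close>, in the closure of
        the tail from \<open>k\<close>; so \<open>W\<close> meets that tail.\<close>
      have "\<exists>m\<ge>k. s m \<in> W" for k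
      proof -
        have "eventually (\<lambda>i. (h \<circ> r) i \<in> W) sequentially"
          using r(2) W by (simp add: limitin_def)
        then obtain N where N: "\<And>i. i \<ge> N \<Longrightarrow> h (r i) \<in> W"
          by (auto simp: eventually_sequentially)
        define i where "i = max N k"
        have "k \<le> r i"
          using seq_suble[OF r(1), of i] by (simp add: i_def)
        then have "h (r i) \<in> F k"
          using h(1) F_mono by blast
        moreover have "h (r i) \<in> W"
          using N by (simp add: i_def)
        ultimately obtain y where "y \<in> s ` {k..}" "y \<in> W"
          using W(1) unfolding F_def in_closure_of by blast
        then show ?thesis
          by auto
      qed
      then show "infinite {n. s n \<in> W}"
        by (auto simp: infinite_nat_iff_unbounded_le)
    qed
    then show "\<exists>a. accumulation_point_of_seq X s a" ..
  qed
  ultimately show ?thesis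
    unfolding strict_q_point_def using sc by metis
qed

context topological_group
begin

lemma strict_q_space_if_strict_q_point_one:
  assumes "strict_q_point T \<one>"
  shows "strict_q_space T"
  unfolding strict_q_space_def
proof
  fix x
  assume "x \<in> topspace T"
  then have x: "x \<in> carrier G"
    by (simp add: topspace_eq_carrier)
  then have "homeomorphic_maps T T (\<lambda>y. x \<otimes> y) (\<lambda>y. inv x \<otimes> y)"
    by (auto simp: homeomorphic_maps_def continuous_map_left_translation topspace_eq_carrier
        m_assoc[symmetric])
  then have "strict_q_point T (x \<otimes> \<one>)"
    using strict_q_point_homeomorphic_image[of T "\<lambda>y. x \<otimes> y" "\<lambda>y. inv x \<otimes> y" \<one>] assms
    by (simp add: topspace_eq_carrier)
  then show "strict_q_point T x"
    using x by simp
qed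

end

section \<open>Filtrations by neighbourhoods of the identity\<close>

text \<open>Starting at the whole group lets every element have an index. In \<open>V_conj\<close>
  the index \<open>m\<close> may depend on \<open>x\<close>; this still suffices for the
  intersection to be normal.\<close>

locale group_filtration = topological_group +
  fixes V :: "nat \<Rightarrow> 'a set"
  assumes V_0: "V 0 = carrier G"
    and V_Suc: "\<And>n. shrinks_to (V n) (V (Suc n))"
    and V_conj: "\<And>n x. x \<in> carrier G \<Longrightarrow> \<exists>m. (\<lambda>v. x \<otimes> v \<otimes> inv x) ` V m \<subseteq> V n"
begin

lemma V_open: "openin T (V n)"
  using V_0 V_Suc topspace_eq_carrier openin_topspace[of T]
  by (cases n) (auto simp: shrinks_to_def)

lemma V_carrier: "V n \<subseteq> carrier G"
  using V_open by (rule openin_subset_carrier)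

lemma V_one: "\<one> \<in> V n"
  using V_0 V_Suc by (cases n) (auto simp: shrinks_to_def)

lemma V_inv: "a \<in> V n \<Longrightarrow> inv a \<in> V n"
  using V_0 V_Suc by (cases n) (auto simp: shrinks_to_def)

lemma V_mult3: "a \<in> V (Suc n) \<Longrightarrow> b \<in> V (Suc n) \<Longrightarrow> c \<in> V (Suc n) \<Longrightarrow> a \<otimes> b \<otimes> c \<in> V n"
  using V_Suc by (auto simp: shrinks_to_def)

lemma V_mult: "a \<in> V (Suc n) \<Longrightarrow> b \<in> V (Suc n) \<Longrightarrow> a \<otimes> b \<in> V n"
  using V_mult3[OF _ _ V_one, of a n b] V_carrier[of "Suc n"] by (auto simp: subset_iff)

lemma V_antimono: "m \<le> n \<Longrightarrow> V n \<subseteq> V m"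
  using lift_Suc_antimono_le[of V] V_Suc shrinks_to_subset by blast

section \<open>The closed normal subgroup cut out by a filtration\<close>

definition core :: "'a set" where
  "core = (\<Inter>n. V n)"

lemma core_carrier: "core \<subseteq> carrier G"
  using V_carrier by (auto simp: core_def)

text \<open>A product or a conjugate lies in \<open>V n\<close> as soon as its ingredients lie in
  some later member, and elements of \<open>core\<close> lie in all of them.\<close>

lemma normal_core: "core \<lhd> G"
  unfolding normal_inv_iff
proof (intro conjI ballI)
  show "subgroup core G"
  proof
    show "core \<subseteq> carrier G"
      by (rule core_carrier)
    show "a \<otimes> b \<in> core" if "a \<in> core" "b \<in> core" for a b
      using that V_mult by (auto simp: core_def)
  qed (use V_one V_inv in \<open>auto simp: core_def\<close>)
  fix x h
  assume x: "x \<in> carrier G" and h: "h \<in> core"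
  show "x \<otimes> h \<otimes> inv x \<in> core"
    unfolding core_def
  proof
    fix n
    obtain m where "(\<lambda>v. x \<otimes> v \<otimes> inv x) ` V m \<subseteq> V n"
      using V_conj[OF x] by blast
    then show "x \<otimes> h \<otimes> inv x \<in> V n"
      using h by (auto simp: core_def)
  qed
qed

lemma subgroup_core: "subgroup core G"
  using normal_core by (rule normal_imp_subgroup)

text \<open>If \<open>x\<close> is outside \<open>V n\<close>, the translate of
  \<open>V (Suc n)\<close> by \<open>x\<close> misses \<open>core\<close>: for a common point
  \<open>y\<close>, both \<open>y\<close> and \<open>inv x \<otimes> y\<close> lie in
  \<open>V (Suc n)\<close>, which would put \<open>x\<close> into \<open>V n\<close>.\<close>

lemma closedin_core: "closedin T core"
proof -
  have "openin T (carrier G - core)"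
  proof (subst openin_subopen, intro ballI)
    fix x
    assume x: "x \<in> carrier G - core"
    then obtain n where n: "x \<notin> V n"
      by (auto simp: core_def)
    let ?W = "{y \<in> carrier G. inv x \<otimes> y \<in> V (Suc n)}"
    have "openin T ?W"
      using x V_open by (intro openin_left_translation_vimage) auto
    moreover have "x \<in> ?W"
      using x V_one by simp
    moreover have "?W \<subseteq> carrier G - core"
    proof
      fix y
      assume y: "y \<in> ?W"
      have "y \<notin> core"
      proof
        assume "y \<in> core"
        then have "y \<in> V (Suc n)"
          by (simp add: core_def)
        then have "y \<otimes> inv (inv x \<otimes> y) \<in> V n"
          using y V_inv V_mult by blast
        moreover have "y \<otimes> inv (inv x \<otimes> y) = x"
          using x y by (simp add: inv_mult_group m_assoc[symmetric])
        ultimately show False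
          using n by simp
      qed
      with y show "y \<in> carrier G - core"
        by blast
    qed
    ultimately show "\<exists>U. openin T U \<and> x \<in> U \<and> U \<subseteq> carrier G - core"
      by blast
  qed
  then show ?thesis
    using core_carrier by (simp add: closedin_def topspace_eq_carrier)
qed

section \<open>The Birkhoff-Kakutani pseudometric of a filtration\<close>

definition gauge :: "'a \<Rightarrow> real" where
  "gauge x = Inf ((\<lambda>n. (1/2) ^ n) ` {n. x \<in> V n})"

lemma gauge_nonneg: "x \<in> carrier G \<Longrightarrow> 0 \<le> gauge x"
  unfolding gauge_def using V_0 by (intro cInf_greatest) auto

lemma gauge_le: "x \<in> V n \<Longrightarrow> gauge x \<le> (1/2) ^ n"
  unfolding gauge_def by (intro cInf_lower) (auto intro: bdd_belowI[of _ 0])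

text \<open>Only powers of 1/2 enter the infimum, so a value strictly below \<open>(1/2) ^ n\<close>
  forces membership at an index beyond \<open>n\<close>. The set of values is nonempty because
  \<open>V 0\<close> is the whole group.\<close>

lemma gauge_less_imp:
  assumes "x \<in> carrier G" "gauge x < (1/2) ^ n"
  shows "x \<in> V (Suc n)"
proof -
  have "\<exists>y\<in>(\<lambda>n. (1/2) ^ n) ` {n. x \<in> V n}. y < (1/2 :: real) ^ n"
    using assms V_0 unfolding gauge_def by (intro cInf_lessD) auto
  then obtain m where m: "x \<in> V m" "(1/2 :: real) ^ m < (1/2) ^ n"
    by auto
  then have "Suc n \<le> m"
    by (simp add: power_strict_decreasing_iff Suc_le_eq)
  then show ?thesis
    using m(1) V_antimono by blast
qed

lemma gauge_one: "gauge \<one> = 0"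
proof (rule ccontr)
  assume "gauge \<one> \<noteq> 0"
  then have "0 < gauge \<one>"
    using gauge_nonneg[of \<one>] by simp
  then obtain n where "(1/2) ^ n < gauge \<one>"
    using real_arch_pow_inv[of "gauge \<one>" "1/2"] by auto
  then show False
    using gauge_le[OF V_one, of n] by simp
qed

text \<open>Were the gauge of the product above \<open>2 * r\<close>, take the least
  \<open>k\<close> with the product outside \<open>V k\<close>. Its gauge is then at most twice
  \<open>(1/2) ^ k\<close>, so \<open>r\<close> is below \<open>(1/2) ^ k\<close> and all factors
  lie in \<open>V (Suc k)\<close>, forcing the product into \<open>V k\<close>.\<close>

lemma gauge_mult3:
  assumes "a \<in> carrier G" "b \<in> carrier G" "c \<in> carrier G" "gauge a \<le> r" "gauge b \<le> r" "gauge c \<le> r"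
  shows "gauge (a \<otimes> b \<otimes> c) \<le> 2 * r"
proof (rule ccontr)
  assume *: "\<not> ?thesis"
  let ?x = "a \<otimes> b \<otimes> c"
  have "0 \<le> r"
    using gauge_nonneg[OF assms(1)] assms(4) by simp
  with * have "0 < gauge ?x"
    by linarith
  then obtain n where "(1/2) ^ n < gauge ?x"
    using real_arch_pow_inv[of "gauge ?x" "1/2"] by auto
  then have "?x \<notin> V n"
    using gauge_le[of ?x n] by auto
  define k where "k = (LEAST n. ?x \<notin> V n)"
  have k: "?x \<notin> V k"
    unfolding k_def using \<open>?x \<notin> V n\<close> by (rule LeastI)
  have "k \<noteq> 0"
    using k V_0 assms by (metis m_closed)
  then obtain j where j: "k = Suc j"
    using not0_implies_Suc by blast
  then have "?x \<in> V j"
    using not_less_Least[of j "\<lambda>n. ?x \<notin> V n"] by (simp add: k_def)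
  then have "gauge ?x \<le> (1/2) ^ j"
    by (rule gauge_le)
  with * have "r < (1/2) ^ k"
    by (simp add: j)
  then have "a \<in> V (Suc k)" "b \<in> V (Suc k)" "c \<in> V (Suc k)"
    using assms by (auto intro!: gauge_less_imp)
  then show False
    using k V_mult3 by blast
qed

definition list_prod :: "'a list \<Rightarrow> 'a" where
  "list_prod xs = foldr (\<otimes>) xs \<one>"

lemma list_prod_simps [simp]:
  "list_prod [] = \<one>" "list_prod (x # xs) = x \<otimes> list_prod xs"
  by (simp_all add: list_prod_def)

lemma list_prod_closed: "set xs \<subseteq> carrier G \<Longrightarrow> list_prod xs \<in> carrier G"
  by (induction xs) auto

lemma list_prod_append:
  "set xs \<subseteq> carrier G \<Longrightarrow> set ys \<subseteq> carrier G \<Longrightarrow> list_prod (xs @ ys) = list_prod xs \<otimes> list_prod ys"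
  by (induction xs) (auto simp: list_prod_closed m_assoc)

lemma sum_list_gauge_nonneg: "set xs \<subseteq> carrier G \<Longrightarrow> 0 \<le> sum_list (map gauge xs)"
  by (induction xs) (auto simp: gauge_nonneg)

text \<open>Cut the chain where its total gauge is halved: both outer pieces satisfy the induction
  hypothesis with half the total.\<close>

lemma gauge_list_prod:
  assumes "set xs \<subseteq> carrier G"
  shows "gauge (list_prod xs) \<le> 2 * sum_list (map gauge xs)"
  using assms
proof (induction xs rule: length_induct)
  case (1 xs)
  define S where "S = sum_list (map gauge xs)"
  have S: "0 \<le> S"
    unfolding S_def using 1(2) by (rule sum_list_gauge_nonneg)
  show ?case
  proof (cases "xs = []")
    case False
    then obtain as b cs where xs: "xs = as @ b # cs"
      and as: "sum_list (map gauge as) \<le> S / 2" and cs: "sum_list (map gauge cs) \<le> S - S / 2"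
      using split_list_sum[of xs "S / 2" gauge] S by (auto simp: S_def[symmetric])
    have carr: "set as \<subseteq> carrier G" "b \<in> carrier G" "set cs \<subseteq> carrier G"
      using 1(2) xs by auto
    have "gauge (list_prod as) \<le> 2 * sum_list (map gauge as)"
        "gauge (list_prod cs) \<le> 2 * sum_list (map gauge cs)"
      using 1(1) carr xs by auto
    then have "gauge (list_prod as) \<le> S" "gauge (list_prod cs) \<le> S"
      using as cs by auto
    moreover have "gauge b \<le> S"
      using sum_list_gauge_nonneg[OF carr(1)] sum_list_gauge_nonneg[OF carr(3)]
      by (simp add: S_def xs)
    ultimately have "gauge (list_prod as \<otimes> b \<otimes> list_prod cs) \<le> 2 * S"
      using carr by (intro gauge_mult3) (auto simp: list_prod_closed)
    moreover have "list_prod xs = list_prod as \<otimes> b \<otimes> list_prod cs"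
      using carr by (simp add: xs list_prod_append list_prod_closed m_assoc)
    ultimately show ?thesis
      by (simp add: S_def)
  qed (simp add: gauge_one)
qed

text \<open>The chain construction in terms of lengths: a chain from the identity to
  \<open>x\<close> is recorded by its successive increments, that is, by a factorization of
  \<open>x\<close>. Unlike \<open>gauge\<close>, this infimum is subadditive.\<close>

definition len :: "'a \<Rightarrow> real" where
  "len x = Inf {sum_list (map gauge xs) | xs. set xs \<subseteq> carrier G \<and> list_prod xs = x}"

lemma len_le:
  assumes "set xs \<subseteq> carrier G"
  shows "len (list_prod xs) \<le> sum_list (map gauge xs)"
  unfolding len_def using assms sum_list_gauge_nonneg
  by (intro cInf_lower) (auto intro!: bdd_belowI[of _ 0])

lemma len_greatest:
  assumes "x \<in> carrier G" "\<And>xs. set xs \<subseteq> carrier G \<Longrightarrow> list_prod xs = x \<Longrightarrow> r \<le> sum_list (map gauge xs)"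
  shows "r \<le> len x"
  unfolding len_def
proof (rule cInf_greatest)
  have "set [x] \<subseteq> carrier G \<and> list_prod [x] = x"
    using assms(1) by simp
  then show "{sum_list (map gauge xs) | xs. set xs \<subseteq> carrier G \<and> list_prod xs = x} \<noteq> {}"
    by blast
qed (use assms(2) in blast)

lemma len_nonneg: "x \<in> carrier G \<Longrightarrow> 0 \<le> len x"
  using len_greatest sum_list_gauge_nonneg by blast

lemma len_le_gauge: "x \<in> carrier G \<Longrightarrow> len x \<le> gauge x"
  using len_le[of "[x]"] by simp

text \<open>The chain estimate bounds the loss in passing to the infimum by a factor 2. Together
  with \<open>len_le_gauge\<close> it makes small length and membership in \<open>V n\<close>
  comparable.\<close>

lemma gauge_le_len: "x \<in> carrier G \<Longrightarrow> gauge x \<le> 2 * len x"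
  using len_greatest[of x "gauge x / 2"] gauge_list_prod by fastforce

text \<open>Concatenated factorizations of \<open>x\<close> and \<open>y\<close> factor the product;
  the infimum is taken over one of them at a time.\<close>

lemma len_mult:
  assumes "x \<in> carrier G" "y \<in> carrier G"
  shows "len (x \<otimes> y) \<le> len x + len y"
proof -
  have "len (x \<otimes> y) - len y \<le> len x"
  proof (rule len_greatest[OF assms(1)])
    fix xs
    assume xs: "set xs \<subseteq> carrier G" "list_prod xs = x"
    have "len (x \<otimes> y) - sum_list (map gauge xs) \<le> len y"
    proof (rule len_greatest[OF assms(2)])
      fix ys
      assume ys: "set ys \<subseteq> carrier G" "list_prod ys = y"
      show "len (x \<otimes> y) - sum_list (map gauge xs) \<le> sum_list (map gauge ys)"
        using len_le[of "xs @ ys"] xs ys by (simp add: list_prod_append)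
    qed
    then show "len (x \<otimes> y) - len y \<le> sum_list (map gauge xs)"
      by simp
  qed
  then show ?thesis
    by simp
qed

text \<open>The exponent \<open>Suc n\<close> absorbs the factor 2 between \<open>gauge\<close> and
  \<open>len\<close>.\<close>

lemma len_less_imp:
  assumes "x \<in> carrier G" "len x < (1/2) ^ Suc n"
  shows "x \<in> V n"
  using gauge_less_imp[of x n] gauge_le_len[of x] assms V_antimono[of n "Suc n"] by auto

lemma len_eq_0_iff:
  assumes "x \<in> carrier G"
  shows "len x = 0 \<longleftrightarrow> x \<in> core"
proof
  assume "len x = 0"
  then show "x \<in> core"
    unfolding core_def using len_less_imp[OF assms] by auto
next
  assume x: "x \<in> core"
  show "len x = 0"
  proof (rule ccontr)
    assume "len x \<noteq> 0"
    then have "0 < len x"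
      using len_nonneg[OF assms] by simp
    then obtain n where "(1/2) ^ n < len x"
      using real_arch_pow_inv[of "len x" "1/2"] by auto
    moreover have "len x \<le> (1/2) ^ n"
      using len_le_gauge[OF assms] gauge_le[of x n] x by (simp add: core_def)
    ultimately show False
      by simp
  qed
qed

text \<open>A left-invariant pseudometric on the group; adding both directions makes it symmetric by
  construction.\<close>

definition ldist :: "'a \<Rightarrow> 'a \<Rightarrow> real" where
  "ldist x y = len (inv x \<otimes> y) + len (inv y \<otimes> x)"

lemma ldist_triangle:
  assumes "x \<in> carrier G" "y \<in> carrier G" "z \<in> carrier G"
  shows "ldist x z \<le> ldist x y + ldist y z"
proof -
  have "len (inv a \<otimes> c) \<le> len (inv a \<otimes> b) + len (inv b \<otimes> c)"
    if "a \<in> carrier G" "b \<in> carrier G" "c \<in> carrier G" for a b c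
    using len_mult[of "inv a \<otimes> b" "inv b \<otimes> c"] inv_mult_mult_cancel[of a b c] that by simp
  from this[of x y z] this[of z y x] show ?thesis
    using assms by (simp add: ldist_def)
qed

lemma inv_mult_commute_mem:
  assumes "x \<in> carrier G" "y \<in> carrier G" "inv x \<otimes> y \<in> V n"
  shows "inv y \<otimes> x \<in> V n"
  using V_inv[OF assms(3)] assms by (simp add: inv_mult_group)

lemma ldist_eq_0_iff:
  assumes "x \<in> carrier G" "y \<in> carrier G"
  shows "ldist x y = 0 \<longleftrightarrow> x <# core = y <# core"
proof -
  have "ldist x y = 0 \<longleftrightarrow> len (inv x \<otimes> y) = 0 \<and> len (inv y \<otimes> x) = 0"
    unfolding ldist_def using assms len_nonneg by (intro add_nonneg_eq_0_iff) auto
  also have "\<dots> \<longleftrightarrow> inv x \<otimes> y \<in> core \<and> inv y \<otimes> x \<in> core"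
    using assms by (simp add: len_eq_0_iff)
  also have "\<dots> \<longleftrightarrow> inv x \<otimes> y \<in> core"
    using inv_mult_commute_mem[OF assms] unfolding core_def by blast
  also have "\<dots> \<longleftrightarrow> x <# core = y <# core"
    using l_coset_eq_iff[OF subgroup_core assms] by simp
  finally show ?thesis .
qed

lemma ldist_less_imp:
  assumes "x \<in> carrier G" "y \<in> carrier G" "ldist x y < (1/2) ^ Suc n"
  shows "inv x \<otimes> y \<in> V n"
proof -
  have "len (inv x \<otimes> y) \<le> ldist x y"
    unfolding ldist_def using len_nonneg[of "inv y \<otimes> x"] assms by simp
  then show ?thesis
    using assms by (intro len_less_imp) auto
qed

lemma ldist_le:
  assumes "x \<in> carrier G" "y \<in> carrier G" "inv x \<otimes> y \<in> V n"
  shows "ldist x y \<le> 2 * (1/2) ^ n"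
proof -
  have "len (inv x \<otimes> y) \<le> (1/2) ^ n"
    using len_le_gauge[of "inv x \<otimes> y"] gauge_le[OF assms(3)] assms by simp
  moreover have "len (inv y \<otimes> x) \<le> (1/2) ^ n"
    using len_le_gauge[of "inv y \<otimes> x"] gauge_le[OF inv_mult_commute_mem[OF assms]] assms by simp
  ultimately show ?thesis
    by (simp add: ldist_def)
qed

end

section \<open>Filtrations whose selections accumulate, and their quotients\<close>

locale q_filtration = group_filtration +
  assumes V_accum: "\<And>s. (\<And>n. s n \<in> V n) \<Longrightarrow> \<exists>a. accumulation_point_of_seq T s a"
begin

text \<open>If no \<open>V n\<close> lies in \<open>W\<close>, select points of \<open>V n\<close>
  outside \<open>W\<close>. Their accumulation point lies in every \<open>V n\<close>, hence in
  \<open>core\<close> and in \<open>W\<close>, which the selection avoids.\<close>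

lemma V_subset_neighbourhood:
  assumes W: "openin T W" "core \<subseteq> W"
  shows "\<exists>n. V n \<subseteq> W"
proof (rule ccontr)
  assume "\<nexists>n. V n \<subseteq> W"
  then have "\<forall>n. \<exists>x. x \<in> V n \<and> x \<notin> W"
    by blast
  then obtain s where s: "\<And>n. s n \<in> V n" "\<And>n. s n \<notin> W"
    by metis
  then obtain a where "accumulation_point_of_seq T s a"
    using V_accum by blast
  then have a: "a \<in> carrier G" "\<And>W. openin T W \<Longrightarrow> a \<in> W \<Longrightarrow> infinite {n. s n \<in> W}"
    by (auto simp: accumulation_point_of_seq_iff topspace_eq_carrier)
  have "a \<in> V n" for n
  proof -
    \<comment> \<open>A late \<open>s m\<close> lies in \<open>V (Suc n)\<close> and is also close
      to \<open>a\<close>; dividing out the difference places \<open>a\<close> in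
      \<open>V n\<close>.\<close>
    have "infinite {m. s m \<in> {y \<in> carrier G. inv a \<otimes> y \<in> V (Suc n)}}"
      using a V_one V_open by (intro a(2) openin_left_translation_vimage) auto
    then obtain m where m: "Suc n \<le> m" "inv a \<otimes> s m \<in> V (Suc n)" "s m \<in> carrier G"
      unfolding infinite_nat_iff_unbounded_le by blast
    have "s m \<in> V (Suc n)"
      using s(1) m(1) V_antimono by blast
    then have "s m \<otimes> inv (inv a \<otimes> s m) \<in> V n"
      using m(2) V_inv V_mult by blast
    moreover have "s m \<otimes> inv (inv a \<otimes> s m) = a"
      using a(1) m(3) by (simp add: inv_mult_group m_assoc[symmetric])
    ultimately show ?thesis
      by simp
  qed
  then have "a \<in> W"
    using W(2) by (auto simp: core_def)
  then show False
    using a(2)[OF W(1)] s(2) by simp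
qed

lemma countable_character_core: "countable_character_in T core"
  unfolding countable_character_in_def
  using V_open V_subset_neighbourhood core_carrier topspace_eq_carrier
  by (intro conjI exI[of _ V]) (auto simp: core_def)

lemma V_subset_translate:
  assumes "openin T W" "x \<in> carrier G" "x <# core \<subseteq> W"
  shows "\<exists>n. \<forall>y\<in>carrier G. inv x \<otimes> y \<in> V n \<longrightarrow> y \<in> W"
proof -
  let ?W = "{y \<in> carrier G. x \<otimes> y \<in> W}"
  have "openin T ?W"
    using assms by (intro openin_left_translation_vimage)
  moreover have "core \<subseteq> ?W"
    using assms core_carrier by (auto simp: l_coset_def)
  ultimately obtain n where n: "V n \<subseteq> ?W"
    using V_subset_neighbourhood by blast
  have "y \<in> W" if y: "y \<in> carrier G" "inv x \<otimes> y \<in> V n" for y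
  proof -
    have "x \<otimes> (inv x \<otimes> y) = y"
      using assms(2) y(1) by (simp add: m_assoc[symmetric])
    then show ?thesis
      using n y(2) by auto
  qed
  then show ?thesis
    by blast
qed

text \<open>Two comparisons are needed: an open saturated set contains a translate of some
  \<open>V n\<close> around each whole coset, and such a translate contains a small
  \<open>ldist\<close> ball. Conversely, every \<open>ldist\<close> ball contains a translate of
  some \<open>V n\<close>.\<close>

lemma metrizable_coset_topology_core: "metrizable_space (coset_topology G T core)"
  unfolding coset_topology_def
proof (rule metrizable_quotient_topology[of _ ldist], unfold topspace_eq_carrier)
  fix S
  assume "S \<subseteq> coset_proj G core ` carrier G"
  let ?P = "{x \<in> carrier G. x <# core \<in> S}"
  show "openin T ?P \<longleftrightarrow>
      (\<forall>x\<in>carrier G. x <# core \<in> S \<longrightarrow>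
        (\<exists>e>0. \<forall>y\<in>carrier G. ldist x y < e \<longrightarrow> y <# core \<in> S))" (is "_ \<longleftrightarrow> ?R")
  proof
    assume P: "openin T ?P"
    show ?R
    proof (intro ballI impI)
      fix x
      assume x: "x \<in> carrier G" "x <# core \<in> S"
      have "x <# core \<subseteq> ?P"
      proof
        fix y
        assume y: "y \<in> x <# core"
        then have "y \<in> carrier G"
          using l_coset_subset_G[OF core_carrier x(1)] by blast
        then show "y \<in> ?P"
          using x y l_repr_independence[OF y x(1) subgroup_core] by simp
      qed
      then obtain n where n: "\<forall>y\<in>carrier G. inv x \<otimes> y \<in> V n \<longrightarrow> y \<in> ?P"
        using V_subset_translate[OF P x(1)] by blast
      then have "\<forall>y\<in>carrier G. ldist x y < (1/2) ^ Suc n \<longrightarrow> y <# core \<in> S"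
        using ldist_less_imp x(1) by blast
      moreover have "0 < (1/2 :: real) ^ Suc n"
        by simp
      ultimately show "\<exists>e>0. \<forall>y\<in>carrier G. ldist x y < e \<longrightarrow> y <# core \<in> S"
        by blast
    qed
  next
    assume R: ?R
    show "openin T ?P"
    proof (subst openin_subopen, intro ballI)
      fix x
      assume x: "x \<in> ?P"
      then obtain e where e: "0 < e" "\<And>y. y \<in> carrier G \<Longrightarrow> ldist x y < e \<Longrightarrow> y <# core \<in> S"
        using R by blast
      \<comment> \<open>Half of \<open>e\<close> compensates for the two summands of
        \<open>ldist\<close>.\<close>
      obtain n where n: "(1/2 :: real) ^ n < e / 2"
        using e(1) real_arch_pow_inv[of "e / 2" "1/2"] by auto
      let ?W = "{y \<in> carrier G. inv x \<otimes> y \<in> V n}"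
      have "openin T ?W"
        using x V_open by (intro openin_left_translation_vimage) auto
      moreover have "x \<in> ?W"
        using x V_one by simp
      moreover have "?W \<subseteq> ?P"
        using x n ldist_le[of x _ n] by (auto intro!: e(2) dest: le_less_trans) fastforce
      ultimately show "\<exists>W. openin T W \<and> x \<in> W \<and> W \<subseteq> ?P"
        by blast
    qed
  qed
next
  show "0 \<le> ldist x y" if "x \<in> carrier G" "y \<in> carrier G" for x y
    using that len_nonneg by (auto simp: ldist_def)
qed (simp_all add: ldist_eq_0_iff ldist_triangle, simp add: ldist_def)

text \<open>If the coset of \<open>x\<close> misses \<open>F\<close>, some translate of
  \<open>V n\<close> by \<open>x\<close> misses \<open>F\<close>. Every coset starting in the
  translate of \<open>V (Suc n)\<close> stays inside the former translate, so the complement of the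
  image of \<open>F\<close> is open.\<close>

lemma closed_map_core: "closed_map T (coset_topology G T core) (coset_proj G core)"
  unfolding closed_map_def
proof (intro allI impI)
  fix F
  assume F: "closedin T F"
  have F_carrier: "F \<subseteq> carrier G"
    using closedin_subset[OF F] by (simp add: topspace_eq_carrier)
  define P where "P = {x \<in> carrier G. x <# core \<notin> coset_proj G core ` F}"
  have P_iff: "x \<in> P \<longleftrightarrow> x \<in> carrier G \<and> (\<forall>y\<in>F. inv x \<otimes> y \<notin> core)" for x
    using l_coset_eq_iff[OF subgroup_core, of x] F_carrier by (fastforce simp: P_def)
  have "openin T P"
  proof (subst openin_subopen, intro ballI)
    fix x
    assume x: "x \<in> P"
    then have xc: "x \<in> carrier G"
      by (simp add: P_def)
    have "openin T (carrier G - F)"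
      using F by (simp add: closedin_def topspace_eq_carrier)
    moreover have "x <# core \<subseteq> carrier G - F"
    proof
      fix y
      assume y: "y \<in> x <# core"
      then have "y \<in> carrier G"
        using l_coset_subset_G[OF core_carrier xc] by blast
      then show "y \<in> carrier G - F"
        using x y mem_l_coset_iff[OF core_carrier xc] by (auto simp: P_iff)
    qed
    ultimately obtain n where n: "\<forall>y\<in>carrier G. inv x \<otimes> y \<in> V n \<longrightarrow> y \<in> carrier G - F"
      using V_subset_translate xc by blast
    let ?W = "{y \<in> carrier G. inv x \<otimes> y \<in> V (Suc n)}"
    have "openin T ?W"
      using xc V_open by (intro openin_left_translation_vimage) auto
    moreover have "x \<in> ?W"
      using xc V_one by simp
    moreover have "?W \<subseteq> P"
    proof
      fix z
      assume z: "z \<in> ?W"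
      have "inv z \<otimes> y \<notin> core" if y: "y \<in> F" for y
      proof
        assume "inv z \<otimes> y \<in> core"
        then have "inv z \<otimes> y \<in> V (Suc n)"
          by (simp add: core_def)
        then have "(inv x \<otimes> z) \<otimes> (inv z \<otimes> y) \<in> V n"
          using z V_mult by blast
        moreover have "(inv x \<otimes> z) \<otimes> (inv z \<otimes> y) = inv x \<otimes> y"
          using inv_mult_mult_cancel[OF xc, of z y] z y F_carrier by blast
        ultimately show False
          using n y F_carrier by auto
      qed
      then show "z \<in> P"
        using z by (simp add: P_iff)
    qed
    ultimately show "\<exists>W. openin T W \<and> x \<in> W \<and> W \<subseteq> P"
      by blast
  qed
  moreover have "{x \<in> topspace T. x <# core \<in> coset_proj G core ` topspace T - coset_proj G core ` F} = P"
    by (auto simp: P_def topspace_eq_carrier)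
  ultimately show "closedin (coset_topology G T core) (coset_proj G core ` F)"
    using F_carrier
    by (auto simp: closedin_def coset_topology_def topspace_quotient_topology
        openin_quotient_topology topspace_eq_carrier)
qed

text \<open>Each fibre of the projection is a left translate of \<open>core\<close>, hence a
  continuous image of a sequentially compact set.\<close>

lemma sequential_perfect_map_core:
  assumes "seq_compactin T core"
  shows "sequential_perfect_map T (coset_topology G T core) (coset_proj G core)"
  unfolding sequential_perfect_map_def
proof (intro conjI ballI)
  show "continuous_map T (coset_topology G T core) (coset_proj G core)"
    unfolding coset_topology_def
    using quotient_map_quotient_topology by (rule quotient_imp_continuous_map)
  show "closed_map T (coset_topology G T core) (coset_proj G core)"
    by (rule closed_map_core)
  fix C
  assume "C \<in> topspace (coset_topology G T core)"
  then obtain x where x: "x \<in> carrier G" "C = x <# core"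
    by (auto simp: coset_topology_def topspace_quotient_topology topspace_eq_carrier)
  have "{y \<in> carrier G. y <# core = C} = {y \<in> carrier G. y \<in> x <# core}"
    using x l_coset_eq_iff[OF subgroup_core x(1)] mem_l_coset_iff[OF core_carrier x(1)] by auto
  also have "\<dots> = x <# core"
    using l_coset_subset_G[OF core_carrier x(1)] by blast
  also have "\<dots> = (\<lambda>y. x \<otimes> y) ` core"
    by (auto simp: l_coset_def)
  finally show "seq_compactin T {y \<in> topspace T. y <# core = C}"
    using seq_compactin_image[OF continuous_map_left_translation[OF x(1)] assms]
    by (simp add: topspace_eq_carrier)
qed

end

section \<open>Existence of filtrations\<close>

text \<open>Terms denoting the members of the closure of a countable family of neighbourhoods of the
  identity under shrinking of binary intersections and conjugation witnesses.\<close>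

datatype nbhd_code = Base nat | Shrink nbhd_code nbhd_code | Conj nbhd_code nat

instance nbhd_code :: countable
  by countable_datatype

text \<open>Here \<open>r\<close> is meant as a chosen shrinking and \<open>g U j\<close> as the
  \<open>j\<close>-th conjugation witness for \<open>U\<close>; the values of \<open>B\<close> are
  the given neighbourhoods.\<close>

primrec nbhd_of ::
  "(nat \<Rightarrow> 'a set) \<Rightarrow> ('a set \<Rightarrow> 'a set) \<Rightarrow> ('a set \<Rightarrow> nat \<Rightarrow> 'a set) \<Rightarrow> nbhd_code \<Rightarrow> 'a set"
  where
    "nbhd_of B r g (Base n) = B n"
  | "nbhd_of B r g (Shrink c d) = r (nbhd_of B r g c \<inter> nbhd_of B r g d)"
  | "nbhd_of B r g (Conj c j) = g (nbhd_of B r g c) j"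

text \<open>Bookkeeping: stage \<open>n\<close> shrinks against the code numbered \<open>n\<close>,
  so the sequence eventually passes below every code, and against the base set with index
  \<open>Suc n\<close>, since \<open>Base 0\<close> is the starting set.\<close>

primrec filtration_code :: "nat \<Rightarrow> nbhd_code" where
  "filtration_code 0 = Base 0"
| "filtration_code (Suc n) = Shrink (Shrink (filtration_code n) (from_nat n)) (Base (Suc n))"

context topological_group
begin

definition conj_witnesses :: "'a set \<Rightarrow> (nat \<Rightarrow> 'a set) \<Rightarrow> bool" where
  "conj_witnesses U g \<longleftrightarrow> (\<forall>j. openin T (g j) \<and> \<one> \<in> g j) \<and>
     (\<forall>x\<in>carrier G. \<exists>j. (\<lambda>v. x \<otimes> v \<otimes> inv x) ` g j \<subseteq> U)"

text \<open>The countable family is nonempty because conjugation by the identity already needs a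
  member; so the natural numbers can enumerate it, possibly with repetitions.\<close>

lemma ex_conj_witnesses:
  assumes "omega_balanced G T" "openin T U" "\<one> \<in> U"
  shows "\<exists>g. conj_witnesses U g"
proof -
  have "neighbourhood_in T \<one> U"
    using assms openin_subset by (fastforce simp: neighbourhood_in_def)
  then obtain \<gamma> where \<gamma>: "countable \<gamma>" "\<forall>V\<in>\<gamma>. openin T V \<and> \<one> \<in> V"
      "\<forall>x\<in>carrier G. \<exists>V\<in>\<gamma>. (\<lambda>v. x \<otimes> v \<otimes> inv x) ` V \<subseteq> U"
    using assms(1) unfolding omega_balanced_def by (elim allE[of _ U]) blast
  have "\<gamma> \<noteq> {}"
    using \<gamma>(3) one_closed by blast
  then obtain g :: "nat \<Rightarrow> 'a set" where g: "\<gamma> = range g"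
    using range_from_nat_into[OF _ \<gamma>(1)] by metis
  have "conj_witnesses U g"
    using \<gamma>(2,3) unfolding conj_witnesses_def g by fast
  then show ?thesis
    by blast
qed

text \<open>Every conjugation witness for a member of the sequence has a code of its own, so a later
  member lies inside it. This closes the circle that witnesses for \<open>V n\<close> must be found
  within a sequence still under construction.\<close>

lemma ex_group_filtration:
  assumes ob: "omega_balanced G T" and B: "\<And>n :: nat. openin T (B n)" "\<And>n. \<one> \<in> B n"
  shows "\<exists>V. group_filtration G T V \<and> (\<forall>n. V (Suc n) \<subseteq> B n)"
proof -
  define r where "r U = (SOME W. shrinks_to U W)" for U
  have r: "shrinks_to U (r U)" if "openin T U" "\<one> \<in> U" for U
    unfolding r_def using ex_shrinks_to[OF that] by (rule someI_ex)
  define g where "g U = (SOME g. conj_witnesses U g)" for U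
  have g: "conj_witnesses U (g U)" if "openin T U" "\<one> \<in> U" for U
    unfolding g_def using ex_conj_witnesses[OF ob that] by (rule someI_ex)
  \<comment> \<open>The shift puts the whole group at index 0, which yields
    \<open>V 0 = carrier G\<close> and matches \<open>B n\<close> with
    \<open>V (Suc n)\<close>.\<close>
  define B' where "B' = case_nat (carrier G) B"
  define E where "E = nbhd_of B' r g"
  have E: "openin T (E c) \<and> \<one> \<in> E c" for c
  proof (induction c)
    case (Base n)
    show ?case
      using B openin_topspace[of T] by (cases n) (auto simp: E_def B'_def topspace_eq_carrier)
  next
    case (Shrink c d)
    then have "shrinks_to (E c \<inter> E d) (r (E c \<inter> E d))"
      by (intro r) auto
    then show ?case
      by (simp add: E_def shrinks_to_def)
  next
    case (Conj c j)
    then show ?case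
      using g by (auto simp: E_def conj_witnesses_def)
  qed
  define V where "V n = E (filtration_code n)" for n
  have r_Int: "shrinks_to (E c \<inter> E d) (E (Shrink c d))" for c d
    using r[of "E c \<inter> E d"] E[of c] E[of d] by (auto simp: E_def)
  have V_Suc: "shrinks_to (E (Shrink (filtration_code n) (from_nat n)) \<inter> E (Base (Suc n))) (V (Suc n))"
    for n
    using r_Int by (simp add: V_def)
  have Shrink_subset: "E (Shrink c d) \<subseteq> E c \<inter> E d" for c d
    using r_Int by (rule shrinks_to_subset)
  have V_E: "V (Suc (to_nat c)) \<subseteq> E c" for c
    using shrinks_to_subset[OF V_Suc[of "to_nat c"]] Shrink_subset[of _ c] by auto
  have "group_filtration G T V"
  proof unfold_locales
    show "V 0 = carrier G"
      by (simp add: V_def E_def B'_def)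
    show "shrinks_to (V n) (V (Suc n))" for n
    proof -
      have "E (Shrink (filtration_code n) (from_nat n)) \<inter> E (Base (Suc n)) \<subseteq> V n"
        using Shrink_subset[of "filtration_code n" "from_nat n"] by (auto simp: V_def)
      then show ?thesis
        using V_Suc[of n] unfolding shrinks_to_def by (meson subsetD)
    qed
    show "\<exists>m. (\<lambda>v. x \<otimes> v \<otimes> inv x) ` V m \<subseteq> V n" if x: "x \<in> carrier G" for n x
    proof -
      have "conj_witnesses (V n) (g (V n))"
        using E by (simp add: g V_def)
      then obtain j where "(\<lambda>v. x \<otimes> v \<otimes> inv x) ` g (V n) j \<subseteq> V n"
        using x unfolding conj_witnesses_def by meson
      moreover have "g (V n) j = E (Conj (filtration_code n) j)"
        by (simp add: V_def E_def)
      ultimately have "(\<lambda>v. x \<otimes> v \<otimes> inv x) ` V (Suc (to_nat (Conj (filtration_code n) j))) \<subseteq> V n"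
        using image_mono[OF V_E[of "Conj (filtration_code n) j"]] by (metis order_trans)
      then show ?thesis ..
    qed
  qed
  moreover have "V (Suc n) \<subseteq> B n" for n
    using shrinks_to_subset[OF V_Suc[of n]] by (auto simp: E_def B'_def)
  ultimately show ?thesis
    by blast
qed

text \<open>Run the filtration inside the sets \<open>N \<inter> U n\<close>: its core then lies in
  \<open>N\<close> and, as a closed subset of the intersection of the \<open>U n\<close>, is
  sequentially compact.\<close>

lemma ex_seq_compact_normal_subgroup:
  assumes ob: "omega_balanced G T" and sq: "strict_q_space T" and O: "openin T N" "\<one> \<in> N"
  shows "\<exists>H. H \<lhd> G \<and> closedin T H \<and> seq_compactin T H \<and> countable_character_in T H \<and> H \<subseteq> N \<and>
           sequential_perfect_map T (coset_topology G T H) (coset_proj G H) \<and>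
           metrizable_space (coset_topology G T H)"
proof -
  obtain U where U: "q_sequence T \<one> U" and sc: "seq_compactin T (\<Inter>n. U n)"
    using sq by (auto simp: strict_q_space_def strict_q_point_def topspace_eq_carrier)
  have "openin T (N \<inter> U n)" "\<one> \<in> N \<inter> U n" for n
    using U O by (auto simp: q_sequence_def)
  then obtain V where "group_filtration G T V" and V: "\<And>n. V (Suc n) \<subseteq> N \<inter> U n"
    using ex_group_filtration[OF ob, of "\<lambda>n. N \<inter> U n"] by blast
  then interpret V: group_filtration G T V
    by blast
  interpret V: q_filtration G T V
  proof unfold_locales
    fix s
    assume "\<And>n. s n \<in> V n"
    \<comment> \<open>\<open>V (Suc n)\<close> lies in \<open>U n\<close>, so the q-sequence applies
      to the shifted selection; dropping one term does not affect which indices occur infinitely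
      often.\<close>
    then have "\<forall>n. s (Suc n) \<in> U n"
      using V by blast
    then obtain a where a: "accumulation_point_of_seq T (\<lambda>n. s (Suc n)) a"
      using U unfolding q_sequence_def by meson
    have "infinite {n. s n \<in> W}" if "openin T W" "a \<in> W" for W
    proof
      assume "finite {n. s n \<in> W}"
      then have "finite (Suc -` {n. s n \<in> W})"
        by (rule finite_vimageI) simp
      then have "finite {n. s (Suc n) \<in> W}"
        by (simp add: vimage_def)
      then show False
        using a that by (simp add: accumulation_point_of_seq_iff)
    qed
    then show "\<exists>a. accumulation_point_of_seq T s a"
      using a by (auto simp: accumulation_point_of_seq_iff)
  qed
  have core_sub: "V.core \<subseteq> N \<inter> (\<Inter>n. U n)"
    using V unfolding V.core_def by blast
  then have core_sc: "seq_compactin T V.core"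
    by (intro seq_compactin_closed_subset[OF sc V.closedin_core]) blast
  show ?thesis
    using V.normal_core V.closedin_core core_sc V.countable_character_core core_sub
      V.sequential_perfect_map_core[OF core_sc] V.metrizable_coset_topology_core
    by blast
qed

end

section \<open>Characterization of omega-balanced strict q-groups\<close>

theorem theorem2p8:
  fixes G :: "('a, 'b) monoid_scheme" and T :: "'a topology"
  assumes "topological_group G T" and "Hausdorff_space T"
  shows "omega_balanced G T \<and> strict_q_space T \<longleftrightarrow>
    (\<forall>V. openin T V \<and> \<one>\<^bsub>G\<^esub> \<in> V \<longrightarrow>
      (\<exists>H. H \<lhd> G \<and> closedin T H \<and> seq_compactin T H \<and> countable_character_in T H \<and> H \<subseteq> V \<and>
        sequential_perfect_map T (coset_topology G T H) (coset_proj G H) \<and>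
        metrizable_space (coset_topology G T H)))"
proof -
  interpret topological_group G T
    by (rule assms(1))
  show ?thesis
  proof (intro iffI allI impI)
    fix V
    assume "omega_balanced G T \<and> strict_q_space T" "openin T V \<and> \<one>\<^bsub>G\<^esub> \<in> V"
    then show "\<exists>H. H \<lhd> G \<and> closedin T H \<and> seq_compactin T H \<and> countable_character_in T H \<and> H \<subseteq> V \<and>
        sequential_perfect_map T (coset_topology G T H) (coset_proj G H) \<and>
        metrizable_space (coset_topology G T H)"
      using ex_seq_compact_normal_subgroup by blast
  next
    assume *: "\<forall>V. openin T V \<and> \<one>\<^bsub>G\<^esub> \<in> V \<longrightarrow>
      (\<exists>H. H \<lhd> G \<and> closedin T H \<and> seq_compactin T H \<and> countable_character_in T H \<and> H \<subseteq> V \<and>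
        sequential_perfect_map T (coset_topology G T H) (coset_proj G H) \<and>
        metrizable_space (coset_topology G T H))"
    then have "omega_balanced G T"
      by (intro omega_balanced_if_countable_character) blast
    \<comment> \<open>The whole group serves as the neighbourhood here; the subgroup it yields
      contains the identity and provides a q-sequence there.\<close>
    moreover have "openin T (carrier G) \<and> \<one>\<^bsub>G\<^esub> \<in> carrier G"
      using openin_topspace[of T] by (simp add: topspace_eq_carrier)
    then obtain H where "H \<lhd> G" "seq_compactin T H" "countable_character_in T H"
      using * by blast
    then have "strict_q_point T \<one>\<^bsub>G\<^esub>"
      using assms(2) normal_imp_subgroup subgroup.one_closed Hausdorff_imp_t1_space
      by (intro strict_q_point_if_seq_compactin[of T H]) blast+
    then have "strict_q_space T"
      by (rule strict_q_space_if_strict_q_point_one)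
    ultimately show "omega_balanced G T \<and> strict_q_space T" ..
  qed
qed

end
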